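(* Let $Q=(Q,\le,\odot,1)$ be a commutative, semicartesian and unital quantale that has no underlying localic structure, i.e. whose underlying complete lattice $(Q,\le)$ is not a locale. Then the category $Sh(Q)$ of sheaves on $Q$ is not an elementary topos.
   Context: A quantale is a complete lattice $(Q,\le)$ with an associative binary operation $\odot$ satisfying $a\odot\bigvee_i b_i=\bigvee_i(a\odot b_i)$ and $(\bigvee_i b_i)\odot a=\bigvee_i(b_i\odot a)$ for all families. It is commutative if $\odot$ is; semicartesian if $a\odot b\le a$ and $a\odot b\le b$ for all $a,b$; unital if $\odot$ has a two-sided identity $1$. A locale is a complete lattice in which finite meets distribute over arbitrary joins (equivalently, a complete Heyting algebra). $Q$ is viewed as a poset category with a unique arrow $v\to u$ iff $v\le u$. A presheaf on $Q$ is a functor $F:Q^{op}\to Set$; for $v\le u$ and $s\in F(u)$ write $s_{|_v}$ for its restriction in $F(v)$. $F$ is a sheaf if for every $u\in Q$ and every family (possibly empty) with $u=\bigvee_{i\in I}u_i$, and every family $(s_i\in F(u_i))_{i\in I}$ with $s_{i|_{u_i\odot u_j}}=s_{j|_{u_i\odot u_j}}$ for all $i,j\in I$, there is a unique $s\in F(u)$ with $s_{|_{u_i}}=s_i$ for all $i$. $Sh(Q)$ is the category of sheaves on $Q$ and natural transformations. An elementary topos is a cartesian closed category with pullbacks, a terminal object and a subobject classifier. *)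

theory Defs
  imports Main "HOL-Library.FuncSet"
begin

unbundle cardinal_syntax

section \<open>Quantales\<close>

locale quantale =
  fixes mult :: "'q::complete_lattice \<Rightarrow> 'q \<Rightarrow> 'q"
  assumes mult_assoc: "mult (mult a b) c = mult a (mult b c)"
    and mult_Sup_right: "mult a (Sup B) = (SUP b\<in>B. mult a b)"
    and mult_Sup_left: "mult (Sup B) a = (SUP b\<in>B. mult b a)"

definition commutative :: "('q \<Rightarrow> 'q \<Rightarrow> 'q) \<Rightarrow> bool" where
  "commutative mult \<longleftrightarrow> (\<forall>a b. mult a b = mult b a)"

definition semicartesian :: "('q::order \<Rightarrow> 'q \<Rightarrow> 'q) \<Rightarrow> bool" where
  "semicartesian mult \<longleftrightarrow> (\<forall>a b. mult a b \<le> a \<and> mult a b \<le> b)"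

definition two_sided_unit :: "('q \<Rightarrow> 'q \<Rightarrow> 'q) \<Rightarrow> 'q \<Rightarrow> bool" where
  "two_sided_unit mult e \<longleftrightarrow> (\<forall>a. mult e a = a \<and> mult a e = a)"

text \<open>The library class \<open>complete_distrib_lattice\<close> demands complete distributivity
  and is therefore strictly stronger than being a locale.\<close>

definition is_locale :: "'q::complete_lattice itself \<Rightarrow> bool" where
  "is_locale _ \<longleftrightarrow> (\<forall>(a::'q) B. inf a (Sup B) = (SUP b\<in>B. inf a b))"


section \<open>Categories and elementary toposes\<close>

record ('o, 'a) cat =
  Obj :: "'o set"
  Hom :: "'o \<Rightarrow> 'o \<Rightarrow> 'a set"
  Id :: "'o \<Rightarrow> 'a"
  Comp :: "'a \<Rightarrow> 'a \<Rightarrow> 'a"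

text \<open>\<open>Comp C g f\<close> is \<open>g\<close> after \<open>f\<close>.\<close>

locale category =
  fixes C :: "('o, 'a) cat"
  assumes Hom_disjoint:
      "\<lbrakk>X \<in> Obj C; Y \<in> Obj C; X' \<in> Obj C; Y' \<in> Obj C; f \<in> Hom C X Y; f \<in> Hom C X' Y'\<rbrakk>
        \<Longrightarrow> X = X' \<and> Y = Y'"
    and Id_in_Hom: "X \<in> Obj C \<Longrightarrow> Id C X \<in> Hom C X X"
    and Comp_in_Hom:
      "\<lbrakk>X \<in> Obj C; Y \<in> Obj C; Z \<in> Obj C; f \<in> Hom C X Y; g \<in> Hom C Y Z\<rbrakk>
        \<Longrightarrow> Comp C g f \<in> Hom C X Z"
    and Comp_Id_right: "\<lbrakk>X \<in> Obj C; Y \<in> Obj C; f \<in> Hom C X Y\<rbrakk> \<Longrightarrow> Comp C f (Id C X) = f"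
    and Comp_Id_left: "\<lbrakk>X \<in> Obj C; Y \<in> Obj C; f \<in> Hom C X Y\<rbrakk> \<Longrightarrow> Comp C (Id C Y) f = f"
    and Comp_assoc:
      "\<lbrakk>W \<in> Obj C; X \<in> Obj C; Y \<in> Obj C; Z \<in> Obj C;
        f \<in> Hom C W X; g \<in> Hom C X Y; h \<in> Hom C Y Z\<rbrakk>
        \<Longrightarrow> Comp C (Comp C h g) f = Comp C h (Comp C g f)"

definition is_terminal :: "('o, 'a) cat \<Rightarrow> 'o \<Rightarrow> bool" where
  "is_terminal C T \<longleftrightarrow> T \<in> Obj C \<and> (\<forall>X\<in>Obj C. \<exists>!f. f \<in> Hom C X T)"

definition is_mono :: "('o, 'a) cat \<Rightarrow> 'o \<Rightarrow> 'o \<Rightarrow> 'a \<Rightarrow> bool" where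
  "is_mono C X Y m \<longleftrightarrow>
     X \<in> Obj C \<and> Y \<in> Obj C \<and> m \<in> Hom C X Y \<and>
     (\<forall>W\<in>Obj C. \<forall>f\<in>Hom C W X. \<forall>g\<in>Hom C W X. Comp C m f = Comp C m g \<longrightarrow> f = g)"

definition is_product :: "('o, 'a) cat \<Rightarrow> 'o \<Rightarrow> 'o \<Rightarrow> 'o \<Rightarrow> 'a \<Rightarrow> 'a \<Rightarrow> bool" where
  "is_product C X Y P p q \<longleftrightarrow>
     P \<in> Obj C \<and> p \<in> Hom C P X \<and> q \<in> Hom C P Y \<and>
     (\<forall>W\<in>Obj C. \<forall>f\<in>Hom C W X. \<forall>g\<in>Hom C W Y.
        \<exists>!h. h \<in> Hom C W P \<and> Comp C p h = f \<and> Comp C q h = g)"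

text \<open>\<open>is_pullback C X Y Z f g P p q\<close>: \<open>P\<close> with \<open>p : P \<rightarrow> X\<close> and \<open>q : P \<rightarrow> Y\<close> is a pullback of
  \<open>f : X \<rightarrow> Z\<close> and \<open>g : Y \<rightarrow> Z\<close>.\<close>

definition is_pullback ::
    "('o, 'a) cat \<Rightarrow> 'o \<Rightarrow> 'o \<Rightarrow> 'o \<Rightarrow> 'a \<Rightarrow> 'a \<Rightarrow> 'o \<Rightarrow> 'a \<Rightarrow> 'a \<Rightarrow> bool" where
  "is_pullback C X Y Z f g P p q \<longleftrightarrow>
     f \<in> Hom C X Z \<and> g \<in> Hom C Y Z \<and>
     P \<in> Obj C \<and> p \<in> Hom C P X \<and> q \<in> Hom C P Y \<and> Comp C f p = Comp C g q \<and>
     (\<forall>W\<in>Obj C. \<forall>a\<in>Hom C W X. \<forall>b\<in>Hom C W Y. Comp C f a = Comp C g b \<longrightarrow>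
        (\<exists>!h. h \<in> Hom C W P \<and> Comp C p h = a \<and> Comp C q h = b))"

text \<open>\<open>is_exponential C A B E P p q ev\<close>: \<open>E\<close> is the exponential \<open>B\<^sup>A\<close> with evaluation
  \<open>ev : P \<rightarrow> B\<close>, where \<open>P\<close> with projections \<open>p\<close>, \<open>q\<close> is a product \<open>E \<times> A\<close>. The arrow \<open>h\<close> below is
  \<open>g \<times> id\<^sub>A : W \<times> A \<rightarrow> E \<times> A\<close>, for an arbitrary choice \<open>R\<close> of the product \<open>W \<times> A\<close>.\<close>

definition is_exponential ::
    "('o, 'a) cat \<Rightarrow> 'o \<Rightarrow> 'o \<Rightarrow> 'o \<Rightarrow> 'o \<Rightarrow> 'a \<Rightarrow> 'a \<Rightarrow> 'a \<Rightarrow> bool" where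
  "is_exponential C A B E P p q ev \<longleftrightarrow>
     E \<in> Obj C \<and> is_product C E A P p q \<and> ev \<in> Hom C P B \<and>
     (\<forall>W\<in>Obj C. \<forall>R r s. is_product C W A R r s \<longrightarrow>
        (\<forall>f\<in>Hom C R B. \<exists>!g. g \<in> Hom C W E \<and>
           (\<exists>h\<in>Hom C R P. Comp C p h = Comp C g r \<and> Comp C q h = s \<and> Comp C ev h = f)))"

definition has_terminal :: "('o, 'a) cat \<Rightarrow> bool" where
  "has_terminal C \<longleftrightarrow> (\<exists>T. is_terminal C T)"

definition has_binary_products :: "('o, 'a) cat \<Rightarrow> bool" where
  "has_binary_products C \<longleftrightarrow> (\<forall>X\<in>Obj C. \<forall>Y\<in>Obj C. \<exists>P p q. is_product C X Y P p q)"

definition has_exponentials :: "('o, 'a) cat \<Rightarrow> bool" where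
  "has_exponentials C \<longleftrightarrow>
     (\<forall>A\<in>Obj C. \<forall>B\<in>Obj C. \<exists>E P p q ev. is_exponential C A B E P p q ev)"

definition has_pullbacks :: "('o, 'a) cat \<Rightarrow> bool" where
  "has_pullbacks C \<longleftrightarrow>
     (\<forall>X\<in>Obj C. \<forall>Y\<in>Obj C. \<forall>Z\<in>Obj C. \<forall>f\<in>Hom C X Z. \<forall>g\<in>Hom C Y Z.
        \<exists>P p q. is_pullback C X Y Z f g P p q)"

definition cartesian_closed :: "('o, 'a) cat \<Rightarrow> bool" where
  "cartesian_closed C \<longleftrightarrow> has_terminal C \<and> has_binary_products C \<and> has_exponentials C"

text \<open>\<open>tr : T \<rightarrow> \<Omega>\<close> with \<open>T\<close> terminal: every mono \<open>m : U \<rightarrow> X\<close> is the pullback of \<open>tr\<close> along a unique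
  characteristic arrow \<open>\<chi> : X \<rightarrow> \<Omega>\<close>; the arrow \<open>b : U \<rightarrow> T\<close> is the only one there is.\<close>

definition is_subobject_classifier :: "('o, 'a) cat \<Rightarrow> 'o \<Rightarrow> 'o \<Rightarrow> 'a \<Rightarrow> bool" where
  "is_subobject_classifier C \<Omega> T tr \<longleftrightarrow>
     \<Omega> \<in> Obj C \<and> is_terminal C T \<and> tr \<in> Hom C T \<Omega> \<and>
     (\<forall>U X m. is_mono C U X m \<longrightarrow>
        (\<exists>!\<chi>. \<chi> \<in> Hom C X \<Omega> \<and> (\<exists>b. is_pullback C X T \<Omega> \<chi> tr U m b)))"

definition has_subobject_classifier :: "('o, 'a) cat \<Rightarrow> bool" where
  "has_subobject_classifier C \<longleftrightarrow> (\<exists>\<Omega> T tr. is_subobject_classifier C \<Omega> T tr)"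

definition elementary_topos :: "('o, 'a) cat \<Rightarrow> bool" where
  "elementary_topos C \<longleftrightarrow>
     category C \<and> cartesian_closed C \<and> has_pullbacks C \<and> has_terminal C \<and>
     has_subobject_classifier C"


section \<open>The category of sets in which sheaves take values\<close>

text \<open>HOL has no type of all sets. The category \<open>Set\<close> is rendered relative to a type \<open>'v\<close> whose
  cardinal is strongly inaccessible: its objects are the small subsets of \<open>'v\<close>, those of cardinality
  less than that of \<open>'v\<close>. This is von Neumann's limitation of size: the small sets are, up to
  bijection, the members of a Grothendieck universe. The strong limit condition provides power
  sets and function sets, regularity provides small unions and small products; for a type
  \<open>'v\<close> in general these would be missing. The countable case is allowed, where \<open>Set\<close> is the
  category of finite sets.\<close>

definition small :: "'v set \<Rightarrow> bool" where
  "small A \<longleftrightarrow> |A| <o |UNIV :: 'v set|"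

definition set_universe :: "'v itself \<Rightarrow> bool" where
  "set_universe _ \<longleftrightarrow>
     infinite (UNIV :: 'v set) \<and>
     regularCard |UNIV :: 'v set| \<and>
     (\<forall>A :: 'v set. |A| <o |UNIV :: 'v set| \<longrightarrow> |Pow A| <o |UNIV :: 'v set| )"


section \<open>Presheaves and sheaves on a quantale\<close>

text \<open>\<open>res F u v s\<close> is the restriction to \<open>v\<close> of \<open>s \<in> sec F u\<close>, for \<open>v \<le> u\<close>. Outside
  \<open>v \<le> u\<close> and \<open>s \<in> sec F u\<close> it is fixed to be \<open>undefined\<close>, so that equality of records is
  equality of functors.\<close>

record ('q, 'v) presheaf =
  sec :: "'q \<Rightarrow> 'v set"
  res :: "'q \<Rightarrow> 'q \<Rightarrow> 'v \<Rightarrow> 'v"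

definition is_presheaf :: "('q::order, 'v) presheaf \<Rightarrow> bool" where
  "is_presheaf F \<longleftrightarrow>
     (\<forall>u. small (sec F u)) \<and>
     (\<forall>u v. v \<le> u \<longrightarrow> res F u v \<in> sec F u \<rightarrow>\<^sub>E sec F v) \<and>
     (\<forall>u v. \<not> v \<le> u \<longrightarrow> res F u v = (\<lambda>_. undefined)) \<and>
     (\<forall>u. \<forall>s\<in>sec F u. res F u u s = s) \<and>
     (\<forall>u v w. w \<le> v \<longrightarrow> v \<le> u \<longrightarrow> (\<forall>s\<in>sec F u. res F v w (res F u v s) = res F u w s))"

text \<open>Unique gluing for one family \<open>(u\<^sub>i, s\<^sub>i)\<^sub>i\<^sub>\<in>\<^sub>I\<close>. Semicartesianness makes the restrictions to
  \<open>u\<^sub>i \<odot> u\<^sub>j\<close> meaningful.\<close>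

definition glues :: "('q::complete_lattice \<Rightarrow> 'q \<Rightarrow> 'q) \<Rightarrow> ('q, 'v) presheaf \<Rightarrow>
    'i set \<Rightarrow> ('i \<Rightarrow> 'q) \<Rightarrow> ('i \<Rightarrow> 'v) \<Rightarrow> bool" where
  "glues mult F I u s \<longleftrightarrow>
     ((\<forall>i\<in>I. s i \<in> sec F (u i)) \<and>
      (\<forall>i\<in>I. \<forall>j\<in>I. res F (u i) (mult (u i) (u j)) (s i) = res F (u j) (mult (u i) (u j)) (s j))
      \<longrightarrow> (\<exists>!t. t \<in> sec F (SUP i\<in>I. u i) \<and> (\<forall>i\<in>I. res F (SUP i\<in>I. u i) (u i) t = s i)))"

text \<open>A family may repeat an element \<open>u\<^sub>i\<close> with different sections \<open>s\<^sub>i\<close>, and this matters when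
  \<open>\<odot>\<close> is not idempotent, so covers are not treated as subsets of \<open>Q\<close>.
  Repeating a pair \<open>(u\<^sub>i, s\<^sub>i)\<close> has no effect, hence index sets \<open>I \<subseteq> Q \<times> V\<close> account for families
  over all index types: see \<open>is_sheaf_glues\<close>.\<close>

definition is_sheaf :: "('q::complete_lattice \<Rightarrow> 'q \<Rightarrow> 'q) \<Rightarrow> ('q, 'v) presheaf \<Rightarrow> bool" where
  "is_sheaf mult F \<longleftrightarrow> is_presheaf F \<and> (\<forall>(I :: ('q \<times> 'v) set) u s. glues mult F I u s)"

lemma is_sheaf_glues:
  fixes I :: "'i set"
  assumes "is_sheaf mult F"
  shows "glues mult F I u s"
proof -
  let ?k = "\<lambda>i. (u i, s i)"
  have "glues mult F (?k ` I) fst snd"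
    using assms by (simp add: is_sheaf_def)
  then show ?thesis
    by (simp add: glues_def image_image)
qed

text \<open>A natural transformation carries its source and target, as its components alone do not
  determine the target.\<close>

type_synonym ('q, 'v) nat_trans =
  "('q, 'v) presheaf \<times> ('q, 'v) presheaf \<times> ('q \<Rightarrow> 'v \<Rightarrow> 'v)"

definition nat_transs ::
    "('q::order, 'v) presheaf \<Rightarrow> ('q, 'v) presheaf \<Rightarrow> ('q, 'v) nat_trans set" where
  "nat_transs F G = {(F, G, \<eta>) | \<eta>.
     (\<forall>u. \<eta> u \<in> sec F u \<rightarrow>\<^sub>E sec G u) \<and>
     (\<forall>u v. v \<le> u \<longrightarrow> (\<forall>s\<in>sec F u. \<eta> v (res F u v s) = res G u v (\<eta> u s)))}"

fun nat_trans_comp :: "('q, 'v) nat_trans \<Rightarrow> ('q, 'v) nat_trans \<Rightarrow> ('q, 'v) nat_trans" where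
  "nat_trans_comp (G', H, \<theta>) (F, G, \<eta>) = (F, H, \<lambda>u. compose (sec F u) (\<theta> u) (\<eta> u))"

definition Sh :: "('q::complete_lattice \<Rightarrow> 'q \<Rightarrow> 'q) \<Rightarrow>
    (('q, 'v) presheaf, ('q, 'v) nat_trans) cat" where
  "Sh mult = \<lparr>Obj = {F. is_sheaf mult F},
              Hom = nat_transs,
              Id = (\<lambda>F. (F, F, \<lambda>u. \<lambda>s\<in>sec F u. s)),
              Comp = nat_trans_comp\<rparr>"

lemma category_Sh: "category (Sh mult :: (('q::complete_lattice, 'v) presheaf, _) cat)"
proof
  fix X Y X' Y' :: "('q, 'v) presheaf" and f
  assume "f \<in> Hom (Sh mult) X Y" "f \<in> Hom (Sh mult) X' Y'"
  then show "X = X' \<and> Y = Y'"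
    by (auto simp: Sh_def nat_transs_def)
next
  fix X :: "('q, 'v) presheaf"
  assume "X \<in> Obj (Sh mult)"
  then show "Id (Sh mult) X \<in> Hom (Sh mult) X X"
    by (auto simp: Sh_def nat_transs_def is_sheaf_def is_presheaf_def Pi_iff PiE_iff)
next
  fix X Y Z :: "('q, 'v) presheaf" and f g
  assume "f \<in> Hom (Sh mult) X Y" "g \<in> Hom (Sh mult) Y Z" "X \<in> Obj (Sh mult)"
  then show "Comp (Sh mult) g f \<in> Hom (Sh mult) X Z"
    by (auto simp: Sh_def nat_transs_def is_sheaf_def is_presheaf_def PiE_iff compose_eq)
next
  fix X Y :: "('q, 'v) presheaf" and f
  assume "f \<in> Hom (Sh mult) X Y"
  then show "Comp (Sh mult) f (Id (Sh mult) X) = f"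
    by (auto simp: Sh_def nat_transs_def PiE_iff compose_def fun_eq_iff extensional_def)
next
  fix X Y :: "('q, 'v) presheaf" and f
  assume "f \<in> Hom (Sh mult) X Y"
  then show "Comp (Sh mult) (Id (Sh mult) Y) f = f"
    by (auto simp: Sh_def nat_transs_def PiE_iff compose_def fun_eq_iff extensional_def)
next
  fix W X Y Z :: "('q, 'v) presheaf" and f g h
  assume "f \<in> Hom (Sh mult) W X" "g \<in> Hom (Sh mult) X Y" "h \<in> Hom (Sh mult) Y Z"
  then show "Comp (Sh mult) (Comp (Sh mult) h g) f = Comp (Sh mult) h (Comp (Sh mult) g f)"
    by (auto simp: Sh_def nat_transs_def PiE_iff compose_def fun_eq_iff)
qed

end

(* Products of representable sheaves Q(-,u) are representables of meets; the multiplication plays no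
   role in them. If the exponential E of Q(-,b) by Q(-,a) exists, then by Yoneda E(w) has at most
   one element, and it has one iff inf w a \<le> b. Any two sections of E are then compatible, so
   gluing shows that the set of w with inf w a \<le> b is closed under joins. Taking b to be a join
   of elements inf w a gives the frame law, so cartesian closedness alone makes Q a locale. *)

theory Submission
  imports Defs
begin

(* The point is chosen to be undefined: restriction maps and natural transformations are undefined
   outside their domain, so that all those into a representable are constant functions. *)
definition representable :: "'q::order \<Rightarrow> ('q, 'v) presheaf" where
  "representable u =
     \<lparr>sec = (\<lambda>v. if v \<le> u then {undefined} else {}), res = (\<lambda>_ _ _. undefined)\<rparr>"

definition yoneda_map :: "('q::order, 'v) presheaf \<Rightarrow> 'q \<Rightarrow> 'v \<Rightarrow> ('q, 'v) nat_trans" where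
  "yoneda_map F u s =
     (representable u, F, \<lambda>v. \<lambda>_\<in>sec (representable u :: ('q, 'v) presheaf) v. res F u v s)"

lemma sec_representable [simp]:
  "sec (representable u) v = (if v \<le> u then {undefined} else {})"
  by (simp add: representable_def)

lemma res_representable [simp]: "res (representable u) v w s = undefined"
  by (simp add: representable_def)

text \<open>A family of sections exists only if every member of the cover lies below
  \<open>u\<close>. Then so does the join, and its single point is the unique gluing. The empty
  cover is included, since \<open>bot\<close> lies below \<open>u\<close>.\<close>

lemma is_sheaf_representable:
  assumes "small {undefined :: 'v}"
  shows "is_sheaf mult (representable u :: ('q::complete_lattice, 'v) presheaf)"
proof -
  have "small ({} :: 'v set)"
    using assms unfolding small_def by (rule ordLeq_ordLess_trans[OF card_of_empty])
  then have "is_presheaf (representable u :: ('q, 'v) presheaf)"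
    using assms by (auto simp: is_presheaf_def fun_eq_iff)
  moreover have "glues mult (representable u :: ('q, 'v) presheaf) I f s"
    for I :: "('q \<times> 'v) set" and f s
    by (auto simp: glues_def SUP_le_iff split: if_splits)
  ultimately show ?thesis
    by (simp add: is_sheaf_def)
qed

lemma nat_transs_representable_unique:
  assumes "f \<in> nat_transs F (representable u)"
  shows "f = (F, representable u, \<lambda>_ _. undefined)"
proof -
  obtain \<eta> where f: "f = (F, representable u, \<eta>)"
    and \<eta>: "\<And>v. \<eta> v \<in> sec F v \<rightarrow>\<^sub>E sec (representable u) v"
    using assms by (auto simp: nat_transs_def)
  have "\<eta> v s = undefined" for v s
    using \<eta>[of v] by (cases "s \<in> sec F v") (auto simp: PiE_iff extensional_def split: if_splits)
  then show ?thesis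
    by (simp add: f fun_eq_iff)
qed

text \<open>All values are \<open>undefined\<close>, so naturality is automatic; the only
  obstruction is a nonempty fibre of \<open>F\<close> over an empty fibre of the
  representable.\<close>

lemma nat_transs_representable_iff:
  "(F, representable u, \<lambda>_ _. undefined) \<in> nat_transs F (representable u) \<longleftrightarrow>
     (\<forall>v. sec F v \<noteq> {} \<longrightarrow> v \<le> u)"
  by (fastforce simp: nat_transs_def PiE_iff extensional_def)

lemma nat_transs_between_representables:
  "nat_transs (representable u) (representable v) =
     (if u \<le> v then {(representable u, representable v, \<lambda>_ _. undefined)} else {})"
proof -
  have "(representable u, representable v, \<lambda>_ _. undefined)
      \<in> nat_transs (representable u) (representable v) \<longleftrightarrow> u \<le> v"
    by (auto simp: nat_transs_representable_iff intro: order_trans)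
  then show ?thesis
    by (auto dest: nat_transs_representable_unique)
qed

lemma yoneda_map_in_nat_transs:
  assumes "is_presheaf F" and "s \<in> sec F u"
  shows "yoneda_map F u s \<in> nat_transs (representable u) F"
  using assms by (auto simp: yoneda_map_def nat_transs_def is_presheaf_def PiE_iff)

text \<open>Evaluation at the point over \<open>u\<close> recovers the section, because
  \<open>res F u u\<close> is the identity on \<open>sec F u\<close>.\<close>

lemma yoneda_map_inject:
  assumes "is_presheaf F" and "s \<in> sec F u" and "t \<in> sec F u"
    and "yoneda_map F u s = yoneda_map F u t"
  shows "s = t"
proof -
  have "res F u u x = snd (snd (yoneda_map F u x)) u undefined" for x
    by (simp add: yoneda_map_def)
  then have "res F u u s = res F u u t"
    using assms(4) by simp
  then show ?thesis
    using assms(1-3) by (simp add: is_presheaf_def)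
qed

lemma nat_transs_representable_nonempty:
  fixes F :: "('q::order, 'v) presheaf"
  assumes "f \<in> nat_transs (representable u) F"
  shows "sec F u \<noteq> {}"
proof -
  obtain \<eta> :: "'q \<Rightarrow> 'v \<Rightarrow> 'v" where "\<And>v. \<eta> v \<in> sec (representable u) v \<rightarrow>\<^sub>E sec F v"
    using assms by (auto simp: nat_transs_def)
  then have "\<eta> u undefined \<in> sec F u"
    by (rule PiE_mem) simp
  then show ?thesis
    by blast
qed

text \<open>Arrows from \<open>W\<close> to both factors exist exactly when every nonempty fibre of
  \<open>W\<close> lies over an element below \<open>u\<close> and below \<open>v\<close>, that is,
  below \<open>inf u v\<close>.\<close>

lemma product_representable:
  fixes mult :: "'q::complete_lattice \<Rightarrow> 'q \<Rightarrow> 'q"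
  assumes "small {undefined :: 'v}"
  shows "is_product (Sh mult) (representable u) (representable v)
     (representable (inf u v) :: ('q, 'v) presheaf)
     (representable (inf u v), representable u, \<lambda>_ _. undefined)
     (representable (inf u v), representable v, \<lambda>_ _. undefined)"
proof -
  let ?C = "Sh mult :: (('q, 'v) presheaf, _) cat"
  let ?P = "representable (inf u v) :: ('q, 'v) presheaf"
  let ?const = "\<lambda>F w. (F, representable w, \<lambda>_ _. undefined) :: ('q, 'v) nat_trans"
  have "\<exists>!h. h \<in> Hom ?C W ?P \<and> Comp ?C (?const ?P u) h = f \<and> Comp ?C (?const ?P v) h = g"
    if f: "f \<in> Hom ?C W (representable u)" and g: "g \<in> Hom ?C W (representable v)" for W f g
  proof (rule ex1I)
    have eqs: "f = ?const W u" "g = ?const W v"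
      using f g by (auto simp: Sh_def intro: nat_transs_representable_unique)
    then have "?const W (inf u v) \<in> Hom ?C W ?P"
      using f g by (simp add: Sh_def nat_transs_representable_iff)
    moreover have "Comp ?C (?const ?P w) (?const W (inf u v)) = ?const W w" for w
      by (simp add: Sh_def compose_def restrict_def)
    ultimately show "?const W (inf u v) \<in> Hom ?C W ?P \<and>
        Comp ?C (?const ?P u) (?const W (inf u v)) = f \<and>
        Comp ?C (?const ?P v) (?const W (inf u v)) = g"
      using eqs by simp
  qed (simp add: Sh_def nat_transs_representable_unique)
  then show ?thesis
    using is_sheaf_representable[OF assms]
    by (simp add: is_product_def Sh_def nat_transs_between_representables)
qed

text \<open>A section over \<open>w\<close> yields an arrow from \<open>representable w\<close> to
  \<open>E\<close>, whose transpose is an arrow from \<open>representable (inf w a)\<close> to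
  \<open>representable b\<close>. There is at most one such arrow, and there is one iff
  \<open>inf w a \<le> b\<close>.\<close>

lemma sections_of_exponential:
  fixes mult :: "'q::complete_lattice \<Rightarrow> 'q \<Rightarrow> 'q"
    and E :: "('q, 'v) presheaf"
  assumes small: "small {undefined :: 'v}"
    and exp: "is_exponential (Sh mult) (representable a) (representable b) E P p q ev"
  shows "s \<in> sec E w \<Longrightarrow> inf w a \<le> b"
    and "s \<in> sec E w \<Longrightarrow> t \<in> sec E w \<Longrightarrow> s = t"
    and "inf w a \<le> b \<Longrightarrow> sec E w \<noteq> {}"
proof -
  let ?C = "Sh mult :: (('q, 'v) presheaf, _) cat"
  let ?W = "representable w :: ('q, 'v) presheaf"
  let ?A = "representable a :: ('q, 'v) presheaf"
  let ?B = "representable b :: ('q, 'v) presheaf"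
  let ?R = "representable (inf w a) :: ('q, 'v) presheaf"
  let ?r = "(?R, ?W, \<lambda>_ _. undefined) :: ('q, 'v) nat_trans"
  let ?s = "(?R, ?A, \<lambda>_ _. undefined) :: ('q, 'v) nat_trans"
  interpret category ?C
    by (rule category_Sh)
  have Obj: "representable u \<in> Obj ?C" for u
    using is_sheaf_representable[OF small] by (simp add: Sh_def)
  have R: "is_product ?C ?W ?A ?R ?r ?s"
    by (rule product_representable[OF small])
  have E: "E \<in> Obj ?C" and P: "is_product ?C E ?A P p q" and ev: "ev \<in> Hom ?C P ?B"
    using exp by (simp_all add: is_exponential_def)
  have presheaf_E: "is_presheaf E"
    using E by (simp add: Sh_def is_sheaf_def)
  have PObj: "P \<in> Obj ?C"
    using P by (simp add: is_product_def)
  have transpose: "\<exists>!g. g \<in> Hom ?C ?W E \<and>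
      (\<exists>h\<in>Hom ?C ?R P. Comp ?C p h = Comp ?C g ?r \<and> Comp ?C q h = ?s \<and> Comp ?C ev h = f)"
    if "f \<in> Hom ?C ?R ?B" for f
    using exp Obj R that unfolding is_exponential_def by blast
  \<comment> \<open>The converse passage, from \<open>g\<close> to the arrow that it transposes: the
    universal property of \<open>P\<close> provides \<open>h\<close>, which is \<open>g\<close>
    times the identity of \<open>?A\<close>, and \<open>ev\<close> is applied after it.\<close>
  have untranspose: "\<exists>h\<in>Hom ?C ?R P. Comp ?C p h = Comp ?C g ?r \<and> Comp ?C q h = ?s \<and>
      Comp ?C ev h \<in> Hom ?C ?R ?B" if "g \<in> Hom ?C ?W E" for g
  proof -
    have "?r \<in> Hom ?C ?R ?W" and s: "?s \<in> Hom ?C ?R ?A"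
      using R by (simp_all add: is_product_def)
    then have "Comp ?C g ?r \<in> Hom ?C ?R E"
      using Comp_in_Hom Obj E that by blast
    then obtain h where "h \<in> Hom ?C ?R P" "Comp ?C p h = Comp ?C g ?r" "Comp ?C q h = ?s"
      using P s Obj unfolding is_product_def by blast
    then show ?thesis
      using Comp_in_Hom Obj PObj ev by blast
  qed
  have Hom_RB: "f = g" if "f \<in> Hom ?C ?R ?B" "g \<in> Hom ?C ?R ?B" for f g
    using that by (simp add: Sh_def nat_transs_between_representables split: if_splits)
  have yoneda: "yoneda_map E w s \<in> Hom ?C ?W E" if "s \<in> sec E w" for s
    using yoneda_map_in_nat_transs[OF presheaf_E that] by (simp add: Sh_def)
  show "inf w a \<le> b" if "s \<in> sec E w" for s
  proof -
    have "Hom ?C ?R ?B \<noteq> {}"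
      using untranspose[OF yoneda[OF that]] by blast
    then show ?thesis
      by (simp add: Sh_def nat_transs_between_representables split: if_splits)
  qed
  show "s = t" if s: "s \<in> sec E w" and t: "t \<in> sec E w" for s t
  proof -
    obtain h where h: "h \<in> Hom ?C ?R P" "Comp ?C p h = Comp ?C (yoneda_map E w s) ?r"
        "Comp ?C q h = ?s" "Comp ?C ev h \<in> Hom ?C ?R ?B"
      using untranspose[OF yoneda[OF s]] by blast
    obtain k where k: "k \<in> Hom ?C ?R P" "Comp ?C p k = Comp ?C (yoneda_map E w t) ?r"
        "Comp ?C q k = ?s" "Comp ?C ev k \<in> Hom ?C ?R ?B"
      using untranspose[OF yoneda[OF t]] by blast
    have "Comp ?C ev k = Comp ?C ev h"
      by (rule Hom_RB[OF k(4) h(4)])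
    \<comment> \<open>Both arrows are transposes of the same arrow \<open>Comp ?C ev h\<close>, so
      uniqueness of the transpose identifies them.\<close>
    then have "yoneda_map E w s = yoneda_map E w t"
      using transpose[OF h(4)] yoneda[OF s] yoneda[OF t] h(1-3) k(1-3) by metis
    then show ?thesis
      by (rule yoneda_map_inject[OF presheaf_E s t])
  qed
  show "sec E w \<noteq> {}" if "inf w a \<le> b"
  proof -
    have "(?R, ?B, \<lambda>_ _. undefined) \<in> Hom ?C ?R ?B"
      using that by (simp add: Sh_def nat_transs_between_representables)
    \<comment> \<open>The transpose of the only arrow from \<open>?R\<close> to \<open>?B\<close>;
      its value at the point over \<open>w\<close> is a section of \<open>E\<close>.\<close>
    then obtain g where "g \<in> Hom ?C ?W E"
      using transpose by blast
    then show ?thesis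
      by (intro nat_transs_representable_nonempty) (simp add: Sh_def)
  qed
qed

lemma inf_Sup_le_if_exponential:
  fixes mult :: "'q::complete_lattice \<Rightarrow> 'q \<Rightarrow> 'q"
    and E :: "('q, 'v) presheaf"
  assumes small: "small {undefined :: 'v}"
    and semi: "semicartesian mult"
    and exp: "is_exponential (Sh mult) (representable a) (representable b) E P p q ev"
    and B: "\<And>w. w \<in> B \<Longrightarrow> inf w a \<le> b"
  shows "inf (Sup B) a \<le> b"
proof -
  have sheaf: "is_sheaf mult E"
    using exp by (simp add: is_exponential_def Sh_def)
  define s where "s w = (SOME x. x \<in> sec E w)" for w
  have s: "s w \<in> sec E w" if "w \<in> B" for w
    using sections_of_exponential(3)[OF small exp B[OF that]] unfolding s_def
    by (simp add: some_in_eq)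
  have res: "res E u v x \<in> sec E v" if "v \<le> u" "x \<in> sec E u" for u v x
    using sheaf that by (auto simp: is_sheaf_def is_presheaf_def PiE_iff)
  \<comment> \<open>Semicartesianness puts \<open>mult v w\<close> below \<open>v\<close> and
    \<open>w\<close>, so both sides are sections of \<open>E\<close> over \<open>mult v w\<close>,
    where there is at most one.\<close>
  have "res E v (mult v w) (s v) = res E w (mult v w) (s w)" if "v \<in> B" "w \<in> B" for v w
    using that semi
    by (intro sections_of_exponential(2)[OF small exp, of _ "mult v w"] res s)
      (auto simp: semicartesian_def)
  \<comment> \<open>The cover of \<open>Sup B\<close> is \<open>B\<close> indexed by itself. Only
    the existence of a glued section matters: a section over \<open>Sup B\<close> forces the
    inequality.\<close>
  then obtain t where "t \<in> sec E (Sup B)"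
    using is_sheaf_glues[OF sheaf, of B "\<lambda>w. w" s] s by (auto simp: glues_def)
  then show ?thesis
    by (rule sections_of_exponential(1)[OF small exp])
qed

theorem mainTheorem3:
  fixes mult :: "'q::complete_lattice \<Rightarrow> 'q \<Rightarrow> 'q" and e :: 'q
  assumes universe: "set_universe TYPE('v)"
    and Q_small: "|UNIV :: 'q set| <o |UNIV :: 'v set|"
    and "quantale mult" and "commutative mult" and "semicartesian mult"
    and "two_sided_unit mult e"
    and "\<not> is_locale TYPE('q)"
  shows "\<not> elementary_topos (Sh mult :: (('q, 'v) presheaf, ('q, 'v) nat_trans) cat)"
proof
  assume "elementary_topos (Sh mult :: (('q, 'v) presheaf, ('q, 'v) nat_trans) cat)"
  then have exps: "has_exponentials (Sh mult :: (('q, 'v) presheaf, ('q, 'v) nat_trans) cat)"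
    by (simp add: elementary_topos_def cartesian_closed_def)
  \<comment> \<open>A singleton is no larger than the nonempty type \<open>'q\<close>, which is
    smaller than \<open>'v\<close>.\<close>
  have small: "small {undefined :: 'v}"
    unfolding small_def
    by (rule ordLeq_ordLess_trans[OF card_of_singl_ordLeq[OF UNIV_not_empty] Q_small])
  have "inf a (Sup B) = (SUP w\<in>B. inf a w)" for a :: 'q and B
  proof (rule antisym)
    \<comment> \<open>The least \<open>b\<close> with \<open>inf w a \<le> b\<close> for all
      \<open>w\<close> in \<open>B\<close>; closure under joins for this \<open>b\<close> is the
      nontrivial half of the frame law.\<close>
    let ?b = "SUP w\<in>B. inf a w"
    obtain E P p q ev where "is_exponential (Sh mult) (representable a) (representable ?b)
        (E :: ('q, 'v) presheaf) P p q ev"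
      using exps is_sheaf_representable[OF small, of mult]
      by (fastforce simp: has_exponentials_def Sh_def)
    then have "inf (Sup B) a \<le> ?b"
      by (rule inf_Sup_le_if_exponential[OF small \<open>semicartesian mult\<close>])
        (subst inf.commute, rule SUP_upper)
    then show "inf a (Sup B) \<le> ?b"
      by (simp add: inf.commute)
    show "?b \<le> inf a (Sup B)"
      by (rule SUP_least) (simp add: Sup_upper le_infI2)
  qed
  then have "is_locale TYPE('q)"
    by (simp add: is_locale_def)
  then show False
    using \<open>\<not> is_locale TYPE('q)\<close> by simp
qed

end
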